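(* Let $n=2p+1$ with $p\ge3$ an integer. For $\lambda\in\mathbb Z_n$ let $F_\lambda=\bigl\{\{\lambda+x,\lambda-x\}:x=1,\dots,p\bigr\}$, a set of edges of the complete graph on the vertex set $\mathbb Z_n$. Let $\lambda,\mu\in\mathbb Z_n$ with $\lambda\ne\mu$ and $\gcd(\lambda-\mu,n)=1$. Then the graph with vertex set $\mathbb Z_n$ and edge set $F_\lambda\cup F_\mu$ is a Hamilton path (a path through all $n$ vertices) with endpoints $\lambda$ and $\mu$.
   Context: $\mathbb Z_n$ is the ring of integers modulo $n$; all arithmetic on vertices is modulo $n$. $\gcd(\lambda-\mu,n)$ is computed with any integer representative of $\lambda-\mu$. *)

theory Defs
  imports "HOL-Number_Theory.Residues"
begin

text \<open>
  An undirected simple graph is given by its vertex set \<open>V\<close> and its set \<open>E\<close> of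
  two-element subsets of \<open>V\<close>.
\<close>

definition complete_edges :: "'a set \<Rightarrow> 'a set set" where
  "complete_edges V = {e. e \<subseteq> V \<and> card e = 2}"

text \<open>
  The graph itself is a path: its vertices can be listed without repetition so that its
  edges are exactly the pairs of consecutive vertices.
\<close>

definition is_path :: "'a set \<Rightarrow> 'a set set \<Rightarrow> 'a \<Rightarrow> 'a \<Rightarrow> bool" where
  "is_path V E u v \<longleftrightarrow>
     (\<exists>vs. vs \<noteq> [] \<and> distinct vs \<and> set vs = V \<and>
           E = {{vs ! i, vs ! Suc i} | i. Suc i < length vs} \<and>
           hd vs = u \<and> last vs = v)"

text \<open>\<open>(W, D)\<close> is a path with endpoints \<open>u\<close>, \<open>v\<close> and a spanning subgraph of \<open>(V, E)\<close>.\<close>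

definition is_Hamilton_path ::
    "'a set \<Rightarrow> 'a set set \<Rightarrow> 'a set \<Rightarrow> 'a set set \<Rightarrow> 'a \<Rightarrow> 'a \<Rightarrow> bool" where
  "is_Hamilton_path V E W D u v \<longleftrightarrow> is_path W D u v \<and> W = V \<and> D \<subseteq> E"

text \<open>
  The ring of integers modulo \<open>n\<close> is \<open>residue_ring n\<close>, with carrier \<open>{0..n - 1}\<close>; for
  \<open>n = 2 * p + 1\<close> the integers \<open>1, \<dots>, p\<close> are themselves elements of the carrier.
\<close>

definition F :: "int \<Rightarrow> int \<Rightarrow> int set set" where
  "F p l = (let R = residue_ring (2 * p + 1) in {{l \<oplus>\<^bsub>R\<^esub> x, l \<ominus>\<^bsub>R\<^esub> x} | x. x \<in> {1..p}})"

end

theory Submission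
  imports Defs
begin

text \<open>
  Modulo the odd number \<open>n = 2 * p + 1\<close>, the set \<open>F p l\<close> consists of all pairs of distinct
  residues with sum \<open>2 * l\<close>. Every residue \<open>a\<close> other than \<open>l\<close> thus has exactly one partner
  \<open>2 * l - a\<close> in \<open>F p l\<close>, whereas \<open>l\<close> has none. The union of \<open>F p l\<close> and \<open>F p m\<close> is therefore
  traversed from \<open>l\<close> by reflecting alternately at \<open>m\<close> and at \<open>l\<close>. With \<open>d = m - l\<close>
  the walk is \<open>l\<close>, \<open>l + 2 * d\<close>, \<open>l - 2 * d\<close>, \<open>l + 4 * d\<close>, \<open>l - 4 * d\<close>, and so on
  up to \<open>l + 2 * p * d\<close>, \<open>l - 2 * p * d\<close>,
  and its last vertex is \<open>m\<close>, because \<open>- 2 * p\<close> is \<open>1\<close> modulo \<open>n\<close>.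
  The multiples of \<open>d\<close> that occur are even numbers between \<open>- 2 * p\<close> and \<open>2 * p\<close>. Two of them
  differ by an even number of absolute value less than \<open>2 * n\<close>, so they are distinct modulo the
  odd number \<open>n\<close>; multiplication by the unit \<open>d\<close> keeps them so. As there are \<open>n\<close> of them,
  the walk meets every residue once. Each edge of the union joins a residue to one of its
  reflections, and these are its neighbours on the walk.
\<close>

text \<open>
  Pairs \<open>l + x\<close>, \<open>l - x\<close> have sum \<open>2 * l\<close>; conversely, a pair with that sum lies symmetrically
  around \<open>l\<close>, and one of its two members is at a distance from \<open>1\<close> to \<open>p\<close> ahead of \<open>l\<close>.
\<close>

lemma F_eq_pairs_with_sum:
  fixes p l :: int
  assumes "p \<ge> 1"
  defines "n \<equiv> 2 * p + 1"
  shows "F p l = {{a, b} | a b. a \<in> {0..<n} \<and> b \<in> {0..<n} \<and> a \<noteq> b \<and> [a + b = 2 * l] (mod n)}"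
    (is "_ = ?S")
proof -
  have n: "n > 1" using assms by simp
  interpret residues n "residue_ring n" by unfold_locales (use n in simp_all)
  have F: "F p l = {{(l + x) mod n, (l - x) mod n} | x. x \<in> {1..p}}"
    unfolding F_def Let_def n_def[symmetric] a_minus_def res_add_eq res_neg_eq
    by (simp add: mod_simps)
  show ?thesis
  proof
    show "F p l \<subseteq> ?S"
    proof
      fix e assume "e \<in> F p l"
      then obtain x where x: "1 \<le> x" "x \<le> p" and e: "e = {(l + x) mod n, (l - x) mod n}"
        unfolding F by auto
      have "(l + x) mod n \<noteq> (l - x) mod n"
      proof
        assume "(l + x) mod n = (l - x) mod n"
        then have "n dvd 2 * x" by (simp add: mod_eq_dvd_iff)
        with x n_def show False using zdvd_imp_le[of n "2 * x"] by linarith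
      qed
      moreover have "[(l + x) mod n + (l - x) mod n = 2 * l] (mod n)"
        by (simp add: cong_def mod_simps)
      ultimately show "e \<in> ?S"
        unfolding e using n by fastforce
    qed
    show "?S \<subseteq> F p l"
    proof
      fix e assume "e \<in> ?S"
      then obtain a b where e: "e = {a, b}" and a: "a \<in> {0..<n}" and b: "b \<in> {0..<n}"
        and ab: "a \<noteq> b" and s: "[a + b = 2 * l] (mod n)" by blast
      define y where "y = (a - l) mod n"
      have y: "0 \<le> y" "y < n" using n by (simp_all add: y_def)
      have sum: "n dvd a + b - 2 * l" using s by (simp add: cong_iff_dvd_diff)
      have diff: "n dvd a - l - y" by (simp add: y_def)
      have A: "a = (l + y) mod n"
        using a by (simp add: y_def mod_simps)
      have "n dvd b - (l - y)"
        using dvd_diff[OF sum diff] by (simp add: algebra_simps)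
      then have "b mod n = (l - y) mod n" by (simp add: mod_eq_dvd_iff)
      then have B: "b = (l - y) mod n" using b by simp
      have "y \<noteq> 0" using A B ab by auto
      show "e \<in> F p l"
      proof (cases "y \<le> p")
        case True
        then show ?thesis unfolding F e using y \<open>y \<noteq> 0\<close> A B by auto
      next
        case False
        have "a = (l - (n - y)) mod n" "b = (l + (n - y)) mod n"
          using A B mod_add_self2[of "l - y" n] minus_mod_self2[of "l + y" n]
          by (simp_all add: algebra_simps)
        moreover have "n - y \<in> {1..p}" using False y n_def by auto
        ultimately show ?thesis unfolding F e by blast
      qed
    qed
  qed
qed

text \<open>The coefficients \<open>0, 2, -2, 4, -4, \<dots>\<close> of \<open>m - l\<close> along the walk.\<close>

definition zigzag :: "nat \<Rightarrow> int" where
  "zigzag i = (if even i then - int i else int i + 1)"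

lemma zigzag_0 [simp]: "zigzag 0 = 0"
  by (simp add: zigzag_def)

lemma zigzag_Suc: "zigzag (Suc i) = (if even i then 2 else 0) - zigzag i"
  by (simp add: zigzag_def)

text \<open>
  All coefficients are even, so a multiple of the odd \<open>n\<close> that is a difference of two of them is
  a multiple of \<open>2 * n\<close>, and the differences are too small for that.
\<close>

lemma inj_on_walk:
  fixes p l d :: int
  assumes "coprime d (2 * p + 1)"
  shows "inj_on (\<lambda>i. (l + zigzag i * d) mod (2 * p + 1)) {..<nat (2 * p + 1)}"
proof (rule inj_onI)
  fix i j
  assume i: "i \<in> {..<nat (2 * p + 1)}" and j: "j \<in> {..<nat (2 * p + 1)}"
    and eq: "(l + zigzag i * d) mod (2 * p + 1) = (l + zigzag j * d) mod (2 * p + 1)"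
  have "2 * p + 1 dvd (zigzag i - zigzag j) * d"
    using eq by (simp add: mod_eq_dvd_iff algebra_simps)
  then have "2 * p + 1 dvd zigzag i - zigzag j"
    using assms by (simp add: coprime_dvd_mult_left_iff coprime_commute)
  moreover have "2 dvd zigzag i - zigzag j" by (simp add: zigzag_def)
  moreover have "coprime (2 * p + 1) 2" by simp
  ultimately have "(2 * p + 1) * 2 dvd zigzag i - zigzag j"
    by (rule divides_mult)
  moreover have "\<bar>zigzag i - zigzag j\<bar> < (2 * p + 1) * 2"
  proof -
    have bound: "\<bar>zigzag k\<bar> \<le> 2 * p" if "k < nat (2 * p + 1)" for k
    proof (cases "even k")
      case False
      then have "int k \<noteq> 2 * p" by presburger
      with that False show ?thesis by (simp add: zigzag_def)
    qed (use that in \<open>simp add: zigzag_def\<close>)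
    show ?thesis using bound[of i] bound[of j] i j by auto
  qed
  ultimately have "zigzag i = zigzag j"
    using dvd_imp_le_int[of "zigzag i - zigzag j" "(2 * p + 1) * 2"] by fastforce
  then show "i = j" by (auto simp: zigzag_def split: if_splits)
qed

theorem lemma4p3:
  fixes n p l m :: int
  assumes "n = 2 * p + 1" and "p \<ge> 3"
    and "l \<in> carrier (residue_ring n)" and "m \<in> carrier (residue_ring n)"
    and "l \<noteq> m" and "gcd (l - m) n = 1"
  shows "is_Hamilton_path
           (carrier (residue_ring n)) (complete_edges (carrier (residue_ring n)))
           (carrier (residue_ring n)) (F p l \<union> F p m) l m"
proof -
  have carrier: "carrier (residue_ring n) = {0..<n}"
    by (auto simp: residue_ring_def)
  have n: "n > 0" using assms by simp
  have l: "l \<in> {0..<n}" and m: "m \<in> {0..<n}" using assms carrier by simp_all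
  define d where "d = m - l"
  have "gcd d n = 1" using assms(6) unfolding d_def by (metis gcd_neg1_int minus_diff_eq)
  then have cop: "coprime d n" by (simp add: coprime_iff_gcd_eq_1)
  define N where "N = nat n"
  define v where "v = (\<lambda>i. (l + zigzag i * d) mod n)"
  have inj: "inj_on v {..<N}"
    using inj_on_walk[of d p l] cop unfolding v_def N_def assms(1) by simp
  have v_in: "v i \<in> {0..<n}" for i using n by (simp add: v_def)
  have "v ` {..<N} \<subseteq> {0..<n}" using v_in by auto
  moreover have "card (v ` {..<N}) = card {0..<n}"
    using card_image[OF inj] by (simp add: N_def)
  ultimately have onto: "v ` {..<N} = {0..<n}"
    by (intro card_subset_eq) simp_all
  have v_start: "v 0 = l" using l by (simp add: v_def)
  have v_end: "v (N - 1) = m"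
  proof -
    have "int (N - 1) = 2 * p" using assms(1,2) by (simp add: N_def)
    moreover from this have "even (N - 1)" by presburger
    ultimately have "zigzag (N - 1) = - 2 * p" by (simp add: zigzag_def)
    then have "v (N - 1) = (m - d * n) mod n"
      by (simp add: v_def d_def assms(1) algebra_simps)
    also have "\<dots> = m mod n" by (simp add: mod_eq_dvd_iff)
    finally show ?thesis using m by simp
  qed
  \<comment> \<open>A step from an even position is a reflection at \<open>m\<close>, one from an odd position at \<open>l\<close>.\<close>
  have step: "[v i + v (Suc i) = 2 * (if even i then m else l)] (mod n)" for i
  proof -
    have "[v i + v (Suc i) = (l + zigzag i * d) + (l + zigzag (Suc i) * d)] (mod n)"
      by (simp add: v_def cong_def mod_simps)
    also have "(l + zigzag i * d) + (l + zigzag (Suc i) * d) = 2 * (if even i then m else l)"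
      by (simp add: zigzag_Suc d_def algebra_simps)
    finally show ?thesis .
  qed
  have partner_unique: "b = b'"
    if "[a + b = c] (mod n)" "[a + b' = c] (mod n)" "b \<in> {0..<n}" "b' \<in> {0..<n}" for a b b' c
  proof -
    have "[a + b = a + b'] (mod n)" using that cong_sym cong_trans by blast
    then have "[b = b'] (mod n)" by (simp only: cong_add_lcancel)
    then show ?thesis using that by (simp add: cong_def)
  qed
  have F: "F p c = {{a, b} | a b. a \<in> {0..<n} \<and> b \<in> {0..<n} \<and> a \<noteq> b \<and> [a + b = 2 * c] (mod n)}"
    for c
    using F_eq_pairs_with_sum[of p c] assms(1,2) by simp
  have edge_on_walk: "\<exists>i. {a, b} = {v i, v (Suc i)} \<and> Suc i < N"
    if a: "a \<in> {0..<n}" and b: "b \<in> {0..<n}" and "a \<noteq> b"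
      and c: "c = l \<or> c = m" and s: "[a + b = 2 * c] (mod n)" for a b c
  proof -
    obtain i where i: "i < N" and ai: "a = v i"
    proof -
      have "a \<in> v ` {..<N}" using a unfolding onto .
      then show thesis using that by blast
    qed
    have "a \<noteq> c"
    proof
      assume "a = c"
      then have "b = a" using partner_unique[OF s _ b a] by (simp only: mult_2 cong_refl)
      with \<open>a \<noteq> b\<close> show False by simp
    qed
    show ?thesis
    proof (cases "c = (if even i then m else l)")
      case True
      \<comment> \<open>The last position is even, and there \<open>a\<close> would be \<open>m\<close> itself.\<close>
      have "N - 1 = 2 * nat p" using assms(1,2) by (simp add: N_def)
      then have "even (N - 1)" by simp
      with True have "i \<noteq> N - 1" using \<open>a \<noteq> c\<close> ai v_end by auto
      then have "Suc i < N" using i by simp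
      moreover have "b = v (Suc i)"
        using partner_unique[OF s _ b v_in] step[of i] True ai by simp
      ultimately show ?thesis using ai by blast
    next
      case False
      \<comment> \<open>The first position is even, and there \<open>a\<close> would be \<open>l\<close> itself.\<close>
      have "i \<noteq> 0"
      proof
        assume "i = 0"
        with False c have "c = l" by simp
        with \<open>a \<noteq> c\<close> ai v_start \<open>i = 0\<close> show False by simp
      qed
      then obtain j where j: "i = Suc j" by (cases i) simp_all
      have "c = (if even j then m else l)" using False c j by (auto split: if_splits)
      then have "b = v j"
        using partner_unique[OF s _ b v_in] step[of j] ai j by (simp add: add.commute)
      then show ?thesis using ai j i by blast
    qed
  qed
  have walk_edge: "{v i, v (Suc i)} \<in> F p l \<union> F p m" if "Suc i < N" for i
  proof -
    have "v i \<noteq> v (Suc i)" using inj_onD[OF inj, of i "Suc i"] that by auto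
    then have "{v i, v (Suc i)} \<in> F p (if even i then m else l)"
      unfolding F using v_in step[of i] by blast
    then show ?thesis by (auto split: if_splits)
  qed
  have edges: "F p l \<union> F p m = {{v i, v (Suc i)} | i. Suc i < N}"
  proof
    show "F p l \<union> F p m \<subseteq> {{v i, v (Suc i)} | i. Suc i < N}"
      using edge_on_walk unfolding F by blast
    show "{{v i, v (Suc i)} | i. Suc i < N} \<subseteq> F p l \<union> F p m"
      using walk_edge by blast
  qed
  define vs where "vs = map v [0..<N]"
  have len: "length vs = N" by (simp add: vs_def)
  have "N > 0" using n by (simp add: N_def)
  have "is_path {0..<n} (F p l \<union> F p m) l m"
    unfolding is_path_def
  proof (intro exI[of _ vs] conjI)
    show "vs \<noteq> []" using len \<open>N > 0\<close> by auto
    show "distinct vs" using inj by (simp add: vs_def distinct_map atLeast0LessThan)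
    show "set vs = {0..<n}" using onto by (simp add: vs_def atLeast0LessThan)
    show "F p l \<union> F p m = {{vs ! i, vs ! Suc i} | i. Suc i < length vs}"
    proof -
      have "vs ! i = v i" if "i < N" for i using that by (simp add: vs_def)
      then have "{vs ! i, vs ! Suc i} = {v i, v (Suc i)}" if "Suc i < N" for i
        using that by simp
      then show ?thesis unfolding edges len by (intro Collect_cong ex_cong1) auto
    qed
    show "hd vs = l" using \<open>N > 0\<close> v_start by (simp add: vs_def hd_map)
    show "last vs = m" using \<open>N > 0\<close> v_end by (simp add: vs_def last_map)
  qed
  moreover have "F p l \<union> F p m \<subseteq> complete_edges {0..<n}"
    unfolding F complete_edges_def by auto
  ultimately show ?thesis
    unfolding is_Hamilton_path_def carrier by simp
qed

end
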